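(* Let $(A,\searrow,\nearrow,\nwarrow,\swarrow)$ be an L-quadri-algebra, and let $(A,\triangleright,\triangleleft)$, $(A,\succ,\prec)$, $(A,\vee,\wedge)$ be its associated horizontal, vertical and depth L-dendriform algebras respectively. For $x,y\in A$: (1) If $x\circ y=x\searrow y+x\swarrow y-y\nwarrow x-y\nearrow x=x\triangleright y-y\triangleleft x=x\vee y-y\wedge x$, then $(A,\circ)$ is a pre-Lie algebra, and it is the associated vertical pre-Lie algebra of both $(A,\triangleright,\triangleleft)$ and $(A,\vee,\wedge)$. (2) If $x\ast y=x\searrow y+x\nearrow y+x\nwarrow y+x\swarrow y=x\succ y+x\prec y=x\vee y+x\wedge y$, then $(A,\ast)$ is a pre-Lie algebra, and it is the associated horizontal pre-Lie algebra of both $(A,\succ,\prec)$ and $(A,\vee,\wedge)$. (3) If $x\bullet y=x\searrow y+x\nearrow y-y\nwarrow x-y\swarrow x=x\triangleright y+x\triangleleft y=x\succ y-y\prec x$, then $(A,\bullet)$ is a pre-Lie algebra, and it is the associated horizontal pre-Lie algebra of $(A,\triangleright,\triangleleft)$ and the associated vertical pre-Lie algebra of $(A,\succ,\prec)$. (4) If $[x,y]=x\searrow y+x\swarrow y+x\nearrow y+x\nwarrow y-(y\searrow x+y\swarrow x+y\nearrow x+y\nwarrow x)$, then $(A,[\,,])$ is a Lie algebra (called the sub-adjacent Lie algebra of the L-quadri-algebra).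
   Context: All algebras are finite-dimensional over a field of characteristic zero. A pre-Lie algebra $(A,\circ)$ is a vector space with a bilinear product such that $(x\circ y)\circ z-x\circ(y\circ z)=(y\circ x)\circ z-y\circ(x\circ z)$ for all $x,y,z$. An L-dendriform algebra $(A,\triangleright,\triangleleft)$ is a vector space $A$ with two bilinear products such that for all $x,y,z\in A$: $x\triangleright(y\triangleright z)-(x\bullet y)\triangleright z=y\triangleright(x\triangleright z)-(y\bullet x)\triangleright z$ and $x\triangleright(y\triangleleft z)-(x\triangleright y)\triangleleft z=y\triangleleft(x\bullet z)-(y\triangleleft x)\triangleleft z$, where $x\bullet y=x\triangleright y+x\triangleleft y$. Its associated horizontal pre-Lie algebra has product $x\triangleright y+x\triangleleft y$, and its associated vertical pre-Lie algebra has product $x\triangleright y-y\triangleleft x$; both are pre-Lie algebras. (For $(A,\succ,\prec)$ or $(A,\vee,\wedge)$ the first listed product plays the role of $\triangleright$ and the second that of $\triangleleft$.) An L-quadri-algebra $(A,\searrow,\nearrow,\nwarrow,\swarrow)$ is a vector space with four bilinear products such that for all $x,y,z\in A$: $x\searrow(y\searrow z)-(x\ast y)\searrow z=y\searrow(x\searrow z)-(y\ast x)\searrow z$; $x\searrow(y\nearrow z)-(x\vee y)\nearrow z=y\nearrow(x\succ z)-(y\wedge x)\nearrow z$; $x\searrow(y\nwarrow z)-(x\searrow y)\nwarrow z=y\nwarrow(x\ast z)-(y\nwarrow x)\nwarrow z$; $x\nearrow(y\prec z)-(x\nearrow y)\nwarrow z=y\swarrow(x\wedge z)-(y\swarrow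 x)\nwarrow z$; $x\searrow(y\swarrow z)-(x\succ y)\swarrow z=y\swarrow(x\vee z)-(y\prec x)\swarrow z$; where $x\succ y=x\searrow y+x\nearrow y$, $x\prec y=x\nwarrow y+x\swarrow y$, $x\vee y=x\searrow y+x\swarrow y$, $x\wedge y=x\nearrow y+x\nwarrow y$, $x\ast y=x\searrow y+x\nearrow y+x\nwarrow y+x\swarrow y$. Its associated vertical, depth and horizontal L-dendriform algebras are $(A,\succ,\prec)$, $(A,\vee,\wedge)$ and $(A,\triangleright,\triangleleft)$, where $x\triangleright y=x\searrow y-y\nwarrow x$ and $x\triangleleft y=x\nearrow y-y\swarrow x$. *)

theory Defs
  imports Complex_Main
begin

locale fin_dim_vector_space = vector_space scale
  for scale :: "'k::field_char_0 \<Rightarrow> 'a::ab_group_add \<Rightarrow> 'a" +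
  assumes finite_dim: "\<exists>B. finite_dimensional_vector_space scale B"

definition bilinear_product ::
    "('k::field \<Rightarrow> 'a::ab_group_add \<Rightarrow> 'a) \<Rightarrow> ('a \<Rightarrow> 'a \<Rightarrow> 'a) \<Rightarrow> bool" where
  "bilinear_product scale f \<longleftrightarrow>
     (\<forall>x. Vector_Spaces.linear scale scale (\<lambda>y. f x y)) \<and>
     (\<forall>y. Vector_Spaces.linear scale scale (\<lambda>x. f x y))"

locale pre_Lie_algebra = fin_dim_vector_space scale
  for scale :: "'k::field_char_0 \<Rightarrow> 'a::ab_group_add \<Rightarrow> 'a" +
  fixes mult :: "'a \<Rightarrow> 'a \<Rightarrow> 'a" (infixl "\<odot>" 70)
  assumes bilinear: "bilinear_product scale mult"
    and left_symmetric:
      "(x \<odot> y) \<odot> z - x \<odot> (y \<odot> z) = (y \<odot> x) \<odot> z - y \<odot> (x \<odot> z)"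

locale Lie_algebra = fin_dim_vector_space scale
  for scale :: "'k::field_char_0 \<Rightarrow> 'a::ab_group_add \<Rightarrow> 'a" +
  fixes bracket :: "'a \<Rightarrow> 'a \<Rightarrow> 'a"
  assumes bilinear: "bilinear_product scale bracket"
    and alternating: "bracket x x = 0"
    and Jacobi: "bracket x (bracket y z) + bracket y (bracket z x) + bracket z (bracket x y) = 0"

locale dendriform_products =
  fixes rtri :: "'a::ab_group_add \<Rightarrow> 'a \<Rightarrow> 'a" (infixl "\<triangleright>" 70)
    and ltri :: "'a \<Rightarrow> 'a \<Rightarrow> 'a" (infixl "\<triangleleft>" 70)
begin

definition horizontal_prod :: "'a \<Rightarrow> 'a \<Rightarrow> 'a" (infixl "\<bullet>" 70) where
  "x \<bullet> y = x \<triangleright> y + x \<triangleleft> y"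

definition vertical_prod :: "'a \<Rightarrow> 'a \<Rightarrow> 'a" where
  "vertical_prod x y = x \<triangleright> y - y \<triangleleft> x"

end

locale L_dendriform_algebra = fin_dim_vector_space scale + dendriform_products rtri ltri
  for scale :: "'k::field_char_0 \<Rightarrow> 'a::ab_group_add \<Rightarrow> 'a"
    and rtri :: "'a \<Rightarrow> 'a \<Rightarrow> 'a" (infixl "\<triangleright>" 70)
    and ltri :: "'a \<Rightarrow> 'a \<Rightarrow> 'a" (infixl "\<triangleleft>" 70) +
  assumes bilinear_rtri: "bilinear_product scale rtri"
    and bilinear_ltri: "bilinear_product scale ltri"
    and L_dend1: "x \<triangleright> (y \<triangleright> z) - (x \<bullet> y) \<triangleright> z = y \<triangleright> (x \<triangleright> z) - (y \<bullet> x) \<triangleright> z"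
    and L_dend2: "x \<triangleright> (y \<triangleleft> z) - (x \<triangleright> y) \<triangleleft> z = y \<triangleleft> (x \<bullet> z) - (y \<triangleleft> x) \<triangleleft> z"

text \<open>
  An associated pre-Lie algebra is only spoken of for an L-dendriform algebra, so both relations
  below require their arguments to be an L-dendriform algebra and a pre-Lie algebra.
\<close>

definition is_horizontal_pre_Lie_of ::
    "('k::field_char_0 \<Rightarrow> 'a::ab_group_add \<Rightarrow> 'a) \<Rightarrow> ('a \<Rightarrow> 'a \<Rightarrow> 'a) \<Rightarrow>
     ('a \<Rightarrow> 'a \<Rightarrow> 'a) \<times> ('a \<Rightarrow> 'a \<Rightarrow> 'a) \<Rightarrow> bool" where
  "is_horizontal_pre_Lie_of scale mult D \<longleftrightarrow>
     (case D of (rtri, ltri) \<Rightarrow>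
        L_dendriform_algebra scale rtri ltri \<and> pre_Lie_algebra scale mult \<and>
        mult = dendriform_products.horizontal_prod rtri ltri)"

definition is_vertical_pre_Lie_of ::
    "('k::field_char_0 \<Rightarrow> 'a::ab_group_add \<Rightarrow> 'a) \<Rightarrow> ('a \<Rightarrow> 'a \<Rightarrow> 'a) \<Rightarrow>
     ('a \<Rightarrow> 'a \<Rightarrow> 'a) \<times> ('a \<Rightarrow> 'a \<Rightarrow> 'a) \<Rightarrow> bool" where
  "is_vertical_pre_Lie_of scale mult D \<longleftrightarrow>
     (case D of (rtri, ltri) \<Rightarrow>
        L_dendriform_algebra scale rtri ltri \<and> pre_Lie_algebra scale mult \<and>
        mult = dendriform_products.vertical_prod rtri ltri)"

locale quadri_products =
  fixes se :: "'a::ab_group_add \<Rightarrow> 'a \<Rightarrow> 'a" (infixl "\<searrow>" 70)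
    and ne :: "'a \<Rightarrow> 'a \<Rightarrow> 'a" (infixl "\<nearrow>" 70)
    and nw :: "'a \<Rightarrow> 'a \<Rightarrow> 'a" (infixl "\<nwarrow>" 70)
    and sw :: "'a \<Rightarrow> 'a \<Rightarrow> 'a" (infixl "\<swarrow>" 70)
begin

definition succ_prod :: "'a \<Rightarrow> 'a \<Rightarrow> 'a" (infixl "\<succ>" 70) where
  "x \<succ> y = x \<searrow> y + x \<nearrow> y"

definition prec_prod :: "'a \<Rightarrow> 'a \<Rightarrow> 'a" (infixl "\<prec>" 70) where
  "x \<prec> y = x \<nwarrow> y + x \<swarrow> y"

definition vee_prod :: "'a \<Rightarrow> 'a \<Rightarrow> 'a" (infixl "\<^bold>\<or>" 70) where
  "x \<^bold>\<or> y = x \<searrow> y + x \<swarrow> y"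

definition wedge_prod :: "'a \<Rightarrow> 'a \<Rightarrow> 'a" (infixl "\<^bold>\<and>" 70) where
  "x \<^bold>\<and> y = x \<nearrow> y + x \<nwarrow> y"

definition total_prod :: "'a \<Rightarrow> 'a \<Rightarrow> 'a" (infixl "\<^bold>*" 70) where
  "x \<^bold>* y = x \<searrow> y + x \<nearrow> y + x \<nwarrow> y + x \<swarrow> y"

definition vertical_L_dendriform :: "('a \<Rightarrow> 'a \<Rightarrow> 'a) \<times> ('a \<Rightarrow> 'a \<Rightarrow> 'a)" where
  "vertical_L_dendriform = (succ_prod, prec_prod)"

definition depth_L_dendriform :: "('a \<Rightarrow> 'a \<Rightarrow> 'a) \<times> ('a \<Rightarrow> 'a \<Rightarrow> 'a)" where
  "depth_L_dendriform = (vee_prod, wedge_prod)"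

definition horizontal_L_dendriform :: "('a \<Rightarrow> 'a \<Rightarrow> 'a) \<times> ('a \<Rightarrow> 'a \<Rightarrow> 'a)" where
  "horizontal_L_dendriform = (\<lambda>x y. x \<searrow> y - y \<nwarrow> x, \<lambda>x y. x \<nearrow> y - y \<swarrow> x)"

end

locale L_quadri_algebra = fin_dim_vector_space scale + quadri_products se ne nw sw
  for scale :: "'k::field_char_0 \<Rightarrow> 'a::ab_group_add \<Rightarrow> 'a"
    and se :: "'a \<Rightarrow> 'a \<Rightarrow> 'a" (infixl "\<searrow>" 70)
    and ne :: "'a \<Rightarrow> 'a \<Rightarrow> 'a" (infixl "\<nearrow>" 70)
    and nw :: "'a \<Rightarrow> 'a \<Rightarrow> 'a" (infixl "\<nwarrow>" 70)
    and sw :: "'a \<Rightarrow> 'a \<Rightarrow> 'a" (infixl "\<swarrow>" 70) +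
  assumes bilinear_se: "bilinear_product scale se"
    and bilinear_ne: "bilinear_product scale ne"
    and bilinear_nw: "bilinear_product scale nw"
    and bilinear_sw: "bilinear_product scale sw"
    and L_quadri1: "x \<searrow> (y \<searrow> z) - (x \<^bold>* y) \<searrow> z = y \<searrow> (x \<searrow> z) - (y \<^bold>* x) \<searrow> z"
    and L_quadri2: "x \<searrow> (y \<nearrow> z) - (x \<^bold>\<or> y) \<nearrow> z = y \<nearrow> (x \<succ> z) - (y \<^bold>\<and> x) \<nearrow> z"
    and L_quadri3: "x \<searrow> (y \<nwarrow> z) - (x \<searrow> y) \<nwarrow> z = y \<nwarrow> (x \<^bold>* z) - (y \<nwarrow> x) \<nwarrow> z"
    and L_quadri4: "x \<nearrow> (y \<prec> z) - (x \<nearrow> y) \<nwarrow> z = y \<swarrow> (x \<^bold>\<and> z) - (y \<swarrow> x) \<nwarrow> z"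
    and L_quadri5: "x \<searrow> (y \<swarrow> z) - (x \<succ> y) \<swarrow> z = y \<swarrow> (x \<^bold>\<or> z) - (y \<prec> x) \<swarrow> z"

end

theory Submission imports Defs begin

text \<open>
  The left-symmetry law of both pre-Lie algebras of an L-dendriform algebra is a signed sum of
  instances of the two L-dendriform laws, and each L-dendriform law of the three algebras
  associated with an L-quadri-algebra is a signed sum of three instances of the five L-quadri
  laws. The identities then hold by biadditivity. The Lie bracket is the commutator of the
  pre-Lie product \<open>x \<ast> y\<close>, whose Jacobi identity follows from left-symmetry.
\<close>

text \<open>\<open>Vector_Spaces.linear\<close> contains the vector space axioms for
  \<open>scale\<close>, which the four equations cannot supply; hence the assumption. The equational
  form serves to prove new products bilinear.\<close>

lemma bilinear_product_iff:
  assumes "vector_space scale"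
  shows "bilinear_product scale f \<longleftrightarrow>
    (\<forall>x y z. f (x + y) z = f x z + f y z) \<and> (\<forall>x y z. f x (y + z) = f x y + f x z) \<and>
    (\<forall>c x y. f (scale c x) y = scale c (f x y)) \<and> (\<forall>c x y. f x (scale c y) = scale c (f x y))"
  using assms unfolding bilinear_product_def Vector_Spaces.linear_iff_module_hom module_hom_iff
    module_iff_vector_space by auto

lemma bilinear_product_add:
  assumes "bilinear_product scale f"
  shows "f (x + y) z = f x z + f y z" "f x (y + z) = f x y + f x z"
  using assms unfolding bilinear_product_def Vector_Spaces.linear_iff_module_hom module_hom_iff
    module_iff_vector_space by auto

text \<open>Additivity at \<open>(x - y) + y = x\<close>, and likewise in the second
  argument.\<close>

lemma bilinear_product_diff:
  assumes "bilinear_product scale f"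
  shows "f (x - y) z = f x z - f y z" "f x (y - z) = f x y - f x z"
  using bilinear_product_add(1)[OF assms, of "x - y" y z]
    bilinear_product_add(2)[OF assms, of x "y - z" z] by (simp_all add: eq_diff_eq)

lemmas bilinear_product_simps = bilinear_product_add bilinear_product_diff

text \<open>Certificate rule behind every law below: each needs exactly three instances of known
  laws. Reversing an instance by \<open>symmetric\<close> gives it a minus sign, and the last
  premise is a pure expansion by biadditivity.\<close>

lemma eq_if_diff_eq_sum3:
  fixes a :: "'a::ab_group_add"
  assumes "a1 = b1" "a2 = b2" "a3 = b3" "a - b = (a1 - b1) + (a2 - b2) + (a3 - b3)"
  shows "a = b"
  using assms by simp

context vector_space
begin

lemma bilinear_product_plus:
  assumes "bilinear_product scale f" "bilinear_product scale g"
  shows "bilinear_product scale (\<lambda>x y. f x y + g x y)"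
  using assms unfolding bilinear_product_iff[OF vector_space_axioms]
  by (auto simp: scale_right_distrib algebra_simps)

text \<open>This shape covers vertical products, the horizontal L-dendriform products and
  commutators alike.\<close>

lemma bilinear_product_minus_flip:
  assumes "bilinear_product scale f" "bilinear_product scale g"
  shows "bilinear_product scale (\<lambda>x y. f x y - g y x)"
  using assms unfolding bilinear_product_iff[OF vector_space_axioms]
  by (auto simp: scale_right_diff_distrib algebra_simps)

end

context L_dendriform_algebra
begin

lemmas dend_bilinear_simps =
  bilinear_product_simps[OF bilinear_rtri] bilinear_product_simps[OF bilinear_ltri]

text \<open>Terms in which \<open>z\<close> meets only \<open>\<triangleright>\<close> form the
  first law; those in which it meets \<open>\<triangleleft>\<close> form the second law
  antisymmetrised in \<open>x\<close> and \<open>y\<close>.\<close>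

lemma horizontal_pre_Lie: "pre_Lie_algebra scale horizontal_prod"
proof
  show "bilinear_product scale horizontal_prod"
    using bilinear_product_plus[OF bilinear_rtri bilinear_ltri]
    by (simp add: horizontal_prod_def[abs_def])
  show "x \<bullet> y \<bullet> z - x \<bullet> (y \<bullet> z) = y \<bullet> x \<bullet> z - y \<bullet> (x \<bullet> z)" for x y z
    by (rule eq_if_diff_eq_sum3[OF L_dend1[of x y z, symmetric] L_dend2[of x y z, symmetric]
          L_dend2[of y x z]])
      (simp add: horizontal_prod_def dend_bilinear_simps algebra_simps)
qed

text \<open>The vertical and horizontal products have the same commutator, so the first law still
  applies. The flip puts \<open>z\<close> to the left of \<open>\<triangleleft>\<close>, so the
  second law is used with \<open>z\<close> in the middle.\<close>

lemma vertical_pre_Lie: "pre_Lie_algebra scale vertical_prod"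
proof
  show "bilinear_product scale vertical_prod"
    using bilinear_product_minus_flip[OF bilinear_rtri bilinear_ltri]
    by (simp add: vertical_prod_def[abs_def])
  show "vertical_prod (vertical_prod x y) z - vertical_prod x (vertical_prod y z) =
      vertical_prod (vertical_prod y x) z - vertical_prod y (vertical_prod x z)" for x y z
    by (rule eq_if_diff_eq_sum3[OF L_dend1[of x y z, symmetric] L_dend2[of x z y]
          L_dend2[of y z x, symmetric]])
      (simp add: horizontal_prod_def vertical_prod_def dend_bilinear_simps algebra_simps)
qed

lemma is_horizontal_pre_Lie_of_self: "is_horizontal_pre_Lie_of scale horizontal_prod (rtri, ltri)"
  unfolding is_horizontal_pre_Lie_of_def
  using L_dendriform_algebra_axioms horizontal_pre_Lie by simp

lemma is_vertical_pre_Lie_of_self: "is_vertical_pre_Lie_of scale vertical_prod (rtri, ltri)"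
  unfolding is_vertical_pre_Lie_of_def
  using L_dendriform_algebra_axioms vertical_pre_Lie by simp

end

lemma (in pre_Lie_algebra) commutator_Lie: "Lie_algebra scale (\<lambda>x y. x \<odot> y - y \<odot> x)"
proof
  show "bilinear_product scale (\<lambda>x y. x \<odot> y - y \<odot> x)"
    by (rule bilinear_product_minus_flip[OF bilinear bilinear])
  show "x \<odot> x - x \<odot> x = 0" for x
    by simp
  show "x \<odot> (y \<odot> z - z \<odot> y) - (y \<odot> z - z \<odot> y) \<odot> x +
      (y \<odot> (z \<odot> x - x \<odot> z) - (z \<odot> x - x \<odot> z) \<odot> y) +
      (z \<odot> (x \<odot> y - y \<odot> x) - (x \<odot> y - y \<odot> x) \<odot> z) = 0" for x y z
    \<comment> \<open>The Jacobi sum expands to twelve terms, four from each cyclic instance of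
      left-symmetry.\<close>
    by (rule eq_if_diff_eq_sum3[OF left_symmetric[of x y z, symmetric] left_symmetric[of y z x, symmetric]
          left_symmetric[of z x y, symmetric]])
      (simp add: bilinear_product_simps[OF bilinear] algebra_simps)
qed

context L_quadri_algebra
begin

lemmas quadri_bilinear_simps =
  bilinear_product_simps[OF bilinear_se] bilinear_product_simps[OF bilinear_ne]
  bilinear_product_simps[OF bilinear_nw] bilinear_product_simps[OF bilinear_sw]

lemmas quadri_prod_defs = succ_prod_def prec_prod_def vee_prod_def wedge_prod_def total_prod_def

text \<open>The first law is \<open>L_quadri1\<close> plus \<open>L_quadri2\<close> antisymmetrised
  in \<open>x\<close> and \<open>y\<close>. The second is the plain sum of \<open>L_quadri3\<close>,
  \<open>L_quadri4\<close> and \<open>L_quadri5\<close>, since \<open>vee_prod\<close> and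
  \<open>wedge_prod\<close> add up to \<open>total_prod\<close>.\<close>

lemma vertical_dendriform: "L_dendriform_algebra scale succ_prod prec_prod"
proof (unfold_locales, unfold dendriform_products.horizontal_prod_def)
  show "bilinear_product scale succ_prod"
    using bilinear_product_plus[OF bilinear_se bilinear_ne] by (simp add: succ_prod_def[abs_def])
  show "bilinear_product scale prec_prod"
    using bilinear_product_plus[OF bilinear_nw bilinear_sw] by (simp add: prec_prod_def[abs_def])
  show "x \<succ> (y \<succ> z) - (x \<succ> y + x \<prec> y) \<succ> z = y \<succ> (x \<succ> z) - (y \<succ> x + y \<prec> x) \<succ> z" for x y z
    by (rule eq_if_diff_eq_sum3[OF L_quadri1[of x y z] L_quadri2[of x y z]
          L_quadri2[of y x z, symmetric]])
      (simp add: quadri_prod_defs quadri_bilinear_simps algebra_simps)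
  show "x \<succ> (y \<prec> z) - x \<succ> y \<prec> z = y \<prec> (x \<succ> z + x \<prec> z) - y \<prec> x \<prec> z" for x y z
    by (rule eq_if_diff_eq_sum3[OF L_quadri3[of x y z] L_quadri4[of x y z] L_quadri5[of x y z]])
      (simp add: quadri_prod_defs quadri_bilinear_simps algebra_simps)
qed

text \<open>Compared with the vertical case \<open>\<nearrow>\<close> and \<open>\<swarrow>\<close>
  change sides: \<open>L_quadri5\<close> takes over the antisymmetrised role in the first law, and
  \<open>L_quadri4\<close> enters the second with \<open>x\<close> and \<open>y\<close> swapped and
  its sides reversed.\<close>

lemma depth_dendriform: "L_dendriform_algebra scale vee_prod wedge_prod"
proof (unfold_locales, unfold dendriform_products.horizontal_prod_def)
  show "bilinear_product scale vee_prod"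
    using bilinear_product_plus[OF bilinear_se bilinear_sw] by (simp add: vee_prod_def[abs_def])
  show "bilinear_product scale wedge_prod"
    using bilinear_product_plus[OF bilinear_ne bilinear_nw] by (simp add: wedge_prod_def[abs_def])
  show "x \<^bold>\<or> (y \<^bold>\<or> z) - (x \<^bold>\<or> y + x \<^bold>\<and> y) \<^bold>\<or> z = y \<^bold>\<or> (x \<^bold>\<or> z) - (y \<^bold>\<or> x + y \<^bold>\<and> x) \<^bold>\<or> z" for x y z
    by (rule eq_if_diff_eq_sum3[OF L_quadri1[of x y z] L_quadri5[of x y z]
          L_quadri5[of y x z, symmetric]])
      (simp add: quadri_prod_defs quadri_bilinear_simps algebra_simps)
  show "x \<^bold>\<or> (y \<^bold>\<and> z) - x \<^bold>\<or> y \<^bold>\<and> z = y \<^bold>\<and> (x \<^bold>\<or> z + x \<^bold>\<and> z) - y \<^bold>\<and> x \<^bold>\<and> z" for x y z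
    by (rule eq_if_diff_eq_sum3[OF L_quadri2[of x y z] L_quadri3[of x y z]
          L_quadri4[of y x z, symmetric]])
      (simp add: quadri_prod_defs quadri_bilinear_simps algebra_simps)
qed

text \<open>The sum of the two products has the commutator of \<open>total_prod\<close>, which
  matches the first law with \<open>L_quadri1\<close> and \<open>L_quadri3\<close>. The flipped
  products place \<open>z\<close> on the left, so \<open>L_quadri3\<close>, \<open>L_quadri4\<close>
  and \<open>L_quadri5\<close> are used with \<open>z\<close> in the middle.\<close>

lemma horizontal_dendriform:
  "L_dendriform_algebra scale (\<lambda>x y. x \<searrow> y - y \<nwarrow> x) (\<lambda>x y. x \<nearrow> y - y \<swarrow> x)"
proof (unfold_locales, unfold dendriform_products.horizontal_prod_def)
  show "bilinear_product scale (\<lambda>x y. x \<searrow> y - y \<nwarrow> x)"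
    by (rule bilinear_product_minus_flip[OF bilinear_se bilinear_nw])
  show "bilinear_product scale (\<lambda>x y. x \<nearrow> y - y \<swarrow> x)"
    by (rule bilinear_product_minus_flip[OF bilinear_ne bilinear_sw])
  show "x \<searrow> (y \<searrow> z - z \<nwarrow> y) - (y \<searrow> z - z \<nwarrow> y) \<nwarrow> x -
      ((x \<searrow> y - y \<nwarrow> x + (x \<nearrow> y - y \<swarrow> x)) \<searrow> z - z \<nwarrow> (x \<searrow> y - y \<nwarrow> x + (x \<nearrow> y - y \<swarrow> x))) =
      y \<searrow> (x \<searrow> z - z \<nwarrow> x) - (x \<searrow> z - z \<nwarrow> x) \<nwarrow> y -
      ((y \<searrow> x - x \<nwarrow> y + (y \<nearrow> x - x \<swarrow> y)) \<searrow> z - z \<nwarrow> (y \<searrow> x - x \<nwarrow> y + (y \<nearrow> x - x \<swarrow> y)))"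
    for x y z
    by (rule eq_if_diff_eq_sum3[OF L_quadri1[of x y z] L_quadri3[of x z y, symmetric]
          L_quadri3[of y z x]])
      (simp add: quadri_prod_defs quadri_bilinear_simps algebra_simps)
  show "x \<searrow> (y \<nearrow> z - z \<swarrow> y) - (y \<nearrow> z - z \<swarrow> y) \<nwarrow> x -
      ((x \<searrow> y - y \<nwarrow> x) \<nearrow> z - z \<swarrow> (x \<searrow> y - y \<nwarrow> x)) =
      y \<nearrow> (x \<searrow> z - z \<nwarrow> x + (x \<nearrow> z - z \<swarrow> x)) - (x \<searrow> z - z \<nwarrow> x + (x \<nearrow> z - z \<swarrow> x)) \<swarrow> y -
      ((y \<nearrow> x - x \<swarrow> y) \<nearrow> z - z \<swarrow> (y \<nearrow> x - x \<swarrow> y))"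
    for x y z
    by (rule eq_if_diff_eq_sum3[OF L_quadri2[of x y z] L_quadri4[of y z x]
          L_quadri5[of x z y, symmetric]])
      (simp add: quadri_prod_defs quadri_bilinear_simps algebra_simps)
qed

end

theorem corollary3p4:
  fixes scale :: "'k::field_char_0 \<Rightarrow> 'a::ab_group_add \<Rightarrow> 'a"
    and se :: "'a \<Rightarrow> 'a \<Rightarrow> 'a" (infixl "\<searrow>" 70)
    and ne :: "'a \<Rightarrow> 'a \<Rightarrow> 'a" (infixl "\<nearrow>" 70)
    and nw :: "'a \<Rightarrow> 'a \<Rightarrow> 'a" (infixl "\<nwarrow>" 70)
    and sw :: "'a \<Rightarrow> 'a \<Rightarrow> 'a" (infixl "\<swarrow>" 70)
    and rtri :: "'a \<Rightarrow> 'a \<Rightarrow> 'a" (infixl "\<triangleright>" 70)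
    and ltri :: "'a \<Rightarrow> 'a \<Rightarrow> 'a" (infixl "\<triangleleft>" 70)
    and succ :: "'a \<Rightarrow> 'a \<Rightarrow> 'a" (infixl "\<succ>" 70)
    and prec :: "'a \<Rightarrow> 'a \<Rightarrow> 'a" (infixl "\<prec>" 70)
    and vee :: "'a \<Rightarrow> 'a \<Rightarrow> 'a" (infixl "\<^bold>\<or>" 70)
    and wedge :: "'a \<Rightarrow> 'a \<Rightarrow> 'a" (infixl "\<^bold>\<and>" 70)
    and circ :: "'a \<Rightarrow> 'a \<Rightarrow> 'a" (infixl "\<odot>" 70)
    and ast :: "'a \<Rightarrow> 'a \<Rightarrow> 'a" (infixl "\<^bold>*" 70)
    and bul :: "'a \<Rightarrow> 'a \<Rightarrow> 'a" (infixl "\<bullet>" 70)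
    and bracket :: "'a \<Rightarrow> 'a \<Rightarrow> 'a"
  assumes "L_quadri_algebra scale se ne nw sw"
    and "(rtri, ltri) = quadri_products.horizontal_L_dendriform se ne nw sw"
    and "(succ, prec) = quadri_products.vertical_L_dendriform se ne nw sw"
    and "(vee, wedge) = quadri_products.depth_L_dendriform se ne nw sw"
  shows
    "((\<forall>x y. x \<odot> y = x \<searrow> y + x \<swarrow> y - y \<nwarrow> x - y \<nearrow> x) \<longrightarrow>
        (\<forall>x y. x \<odot> y = x \<triangleright> y - y \<triangleleft> x) \<and>
        (\<forall>x y. x \<odot> y = x \<^bold>\<or> y - y \<^bold>\<and> x) \<and>
        pre_Lie_algebra scale circ \<and>
        is_vertical_pre_Lie_of scale circ (rtri, ltri) \<and>
        is_vertical_pre_Lie_of scale circ (vee, wedge)) \<and>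
     ((\<forall>x y. x \<^bold>* y = x \<searrow> y + x \<nearrow> y + x \<nwarrow> y + x \<swarrow> y) \<longrightarrow>
        (\<forall>x y. x \<^bold>* y = x \<succ> y + x \<prec> y) \<and>
        (\<forall>x y. x \<^bold>* y = x \<^bold>\<or> y + x \<^bold>\<and> y) \<and>
        pre_Lie_algebra scale ast \<and>
        is_horizontal_pre_Lie_of scale ast (succ, prec) \<and>
        is_horizontal_pre_Lie_of scale ast (vee, wedge)) \<and>
     ((\<forall>x y. x \<bullet> y = x \<searrow> y + x \<nearrow> y - y \<nwarrow> x - y \<swarrow> x) \<longrightarrow>
        (\<forall>x y. x \<bullet> y = x \<triangleright> y + x \<triangleleft> y) \<and>
        (\<forall>x y. x \<bullet> y = x \<succ> y - y \<prec> x) \<and>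
        pre_Lie_algebra scale bul \<and>
        is_horizontal_pre_Lie_of scale bul (rtri, ltri) \<and>
        is_vertical_pre_Lie_of scale bul (succ, prec)) \<and>
     ((\<forall>x y. bracket x y = x \<searrow> y + x \<swarrow> y + x \<nearrow> y + x \<nwarrow> y
                          - (y \<searrow> x + y \<swarrow> x + y \<nearrow> x + y \<nwarrow> x)) \<longrightarrow>
        Lie_algebra scale bracket)"
proof -
  interpret Q: L_quadri_algebra scale se ne nw sw
    by fact
  have hor: "rtri = (\<lambda>x y. x \<searrow> y - y \<nwarrow> x)" "ltri = (\<lambda>x y. x \<nearrow> y - y \<swarrow> x)"
    using assms(2) by (simp_all add: Q.horizontal_L_dendriform_def)
  have ver: "succ = Q.succ_prod" "prec = Q.prec_prod"
    using assms(3) by (simp_all add: Q.vertical_L_dendriform_def)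
  have dep: "vee = Q.vee_prod" "wedge = Q.wedge_prod"
    using assms(4) by (simp_all add: Q.depth_L_dendriform_def)
  interpret H: L_dendriform_algebra scale rtri ltri
    unfolding hor by (rule Q.horizontal_dendriform)
  interpret V: L_dendriform_algebra scale succ prec
    unfolding ver by (rule Q.vertical_dendriform)
  interpret D: L_dendriform_algebra scale vee wedge
    unfolding dep by (rule Q.depth_dendriform)
  \<comment> \<open>Equality as functions is what \<open>is_vertical_pre_Lie_of\<close> demands; the
    results on L-dendriform algebras then transfer by substitution.\<close>
  have circ: "circ = H.vertical_prod \<and> circ = D.vertical_prod"
    if "\<forall>x y. circ x y = x \<searrow> y + x \<swarrow> y - y \<nwarrow> x - y \<nearrow> x"
    using that by (auto simp: fun_eq_iff dendriform_products.vertical_prod_def hor dep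
        Q.quadri_prod_defs algebra_simps)
  have ast: "ast = V.horizontal_prod \<and> ast = D.horizontal_prod"
    if "\<forall>x y. ast x y = x \<searrow> y + x \<nearrow> y + x \<nwarrow> y + x \<swarrow> y"
    using that by (auto simp: fun_eq_iff dendriform_products.horizontal_prod_def ver dep
        Q.quadri_prod_defs algebra_simps)
  have bul: "bul = H.horizontal_prod \<and> bul = V.vertical_prod"
    if "\<forall>x y. bul x y = x \<searrow> y + x \<nearrow> y - y \<nwarrow> x - y \<swarrow> x"
    using that by (auto simp: fun_eq_iff dendriform_products.horizontal_prod_def
        dendriform_products.vertical_prod_def hor ver Q.quadri_prod_defs algebra_simps)
  \<comment> \<open>\<open>ast\<close> is determined only under the premise of the second claim, so
    the total product appears here as the horizontal product of \<open>(succ, prec)\<close>, already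
    known to be pre-Lie.\<close>
  have bracket: "bracket = (\<lambda>x y. V.horizontal_prod x y - V.horizontal_prod y x)"
    if "\<forall>x y. bracket x y = x \<searrow> y + x \<swarrow> y + x \<nearrow> y + x \<nwarrow> y
                         - (y \<searrow> x + y \<swarrow> x + y \<nearrow> x + y \<nwarrow> x)"
    using that by (auto simp: fun_eq_iff dendriform_products.horizontal_prod_def ver
        Q.quadri_prod_defs algebra_simps)
  show ?thesis
  \<comment> \<open>Only conjunctions whose left side is an implication are split, which leaves one
    goal per claim with its conclusion intact.\<close>
  proof (intro conjI[of "_ \<longrightarrow> _"] impI, goal_cases)
    case 1
    with circ show ?case
      using H.vertical_pre_Lie H.is_vertical_pre_Lie_of_self D.is_vertical_pre_Lie_of_self
        H.vertical_prod_def D.vertical_prod_def by metis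
  next
    case 2
    with ast show ?case
      using V.horizontal_pre_Lie V.is_horizontal_pre_Lie_of_self D.is_horizontal_pre_Lie_of_self
        V.horizontal_prod_def D.horizontal_prod_def by metis
  next
    case 3
    with bul show ?case
      using H.horizontal_pre_Lie H.is_horizontal_pre_Lie_of_self V.is_vertical_pre_Lie_of_self
        H.horizontal_prod_def V.vertical_prod_def by metis
  next
    case 4
    with bracket show ?case
      using pre_Lie_algebra.commutator_Lie[OF V.horizontal_pre_Lie] by simp
  qed
qed

end
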